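(* Let $n$ be a positive integer, let $1\le k\le n$, and let $1\le i_1<i_2<\cdots<i_k\le n$ be integers. Let $A$ and $B$ be $n\times n$ complex positive semidefinite matrices. Then $$\prod_{t=1}^k\lambda_{i_t}^{\frac1k}(A+B)\ \ge\ \prod_{t=1}^k\lambda_{i_t}^{\frac1k}(A)+\prod_{t=1}^k\lambda_{n-t+1}^{\frac1k}(B)$$ and $$\prod_{t=1}^k\lambda_{i_t}(A+B)\ \ge\ \prod_{t=1}^k\lambda_{i_t}(A)+\prod_{t=1}^k\lambda_{n-t+1}(B)+(2^k-2)\prod_{t=1}^k\left[\lambda_{i_t}(A)\,\lambda_{n-t+1}(B)\right]^{\frac12}.$$
   Context: For an $n\times n$ complex matrix $X$ with all eigenvalues real, $\lambda_1(X)\ge\lambda_2(X)\ge\cdots\ge\lambda_n(X)$ denote its eigenvalues (with multiplicity) in decreasing order; $\lambda_j^{1/k}(X)$ means $(\lambda_j(X))^{1/k}$. Positive semidefinite matrices are understood to be Hermitian. *)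

theory Defs
  imports
    "Jordan_Normal_Form.Char_Poly"
    "Jordan_Normal_Form.Schur_Decomposition"
    "HOL-Library.Multiset"
begin

definition hermitian_mat :: "complex mat \<Rightarrow> bool" where
  "hermitian_mat A \<longleftrightarrow> square_mat A \<and> mat_adjoint A = A"

definition psd_mat :: "complex mat \<Rightarrow> bool" where
  "psd_mat A \<longleftrightarrow> hermitian_mat A \<and>
     (\<forall>v \<in> carrier_vec (dim_row A). 0 \<le> Re ((A *\<^sub>v v) \<bullet>c v))"

text \<open>
  The eigenvalues with algebraic multiplicity are the roots of the characteristic polynomial.
  Taking real parts only converts the type: the definition is meant for matrices
  all of whose eigenvalues are real.
\<close>

definition eigenvalues_desc :: "complex mat \<Rightarrow> real list" where
  "eigenvalues_desc X = rev (sorted_list_of_multiset (image_mset Re (proots (char_poly X))))"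

text \<open>The index \<open>j\<close> is 1-based: \<open>eig 1 X\<close> is the largest eigenvalue of an \<open>n \<times> n\<close> matrix \<open>X\<close>
  and \<open>eig n X\<close> the smallest; only \<open>1 \<le> j \<le> n\<close> is meaningful.\<close>

definition eig :: "nat \<Rightarrow> complex mat \<Rightarrow> real" where
  "eig j X = eigenvalues_desc X ! (j - 1)"

end

theory Submission
  imports Defs "HOL-Analysis.Convex"
begin

text \<open>
  Write \<open>\<lambda>(j, X)\<close> for the \<open>j\<close>-th largest eigenvalue of \<open>X\<close>, and put
  \<open>d\<^sub>t = \<lambda>(i\<^sub>t, A + B) - \<lambda>(i\<^sub>t, A)\<close> and \<open>b\<^sub>t = \<lambda>(n - t + 1, B)\<close>. By Lidskii's inequality
  the sum of any \<open>s\<close> of the \<open>d\<^sub>t\<close> is at least \<open>b\<^sub>1 + \<dots> + b\<^sub>s\<close>, and this weak majorization gives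
  \<open>\<Prod> d\<^sub>t \<ge> \<Prod> b\<^sub>t\<close>. The first inequality is then the scalar Minkowski inequality for the numbers
  \<open>\<lambda>(i\<^sub>t, A)\<close> and \<open>d\<^sub>t\<close>; its \<open>k\<close>-th power gives the second, since the mixed terms of \<open>(x + y)\<^sup>k\<close>
  are at least \<open>(2\<^sup>k - 2) (x y)\<^sup>k\<^sup>/\<^sup>2\<close>.
\<close>

section \<open>Spectral theorem\<close>

lemma mat_adjoint_carrier [simp]:
  "A \<in> carrier_mat m n \<Longrightarrow> mat_adjoint A \<in> carrier_mat n m"
  by (auto simp: mat_adjoint_def)

lemma mat_adjoint_dim [simp]:
  "dim_row (mat_adjoint A) = dim_col A" "dim_col (mat_adjoint A) = dim_row A"
  by (auto simp: mat_adjoint_def)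

lemma mat_adjoint_index [simp]:
  "i < dim_col A \<Longrightarrow> j < dim_row A \<Longrightarrow> mat_adjoint A $$ (i, j) = conjugate (A $$ (j, i))"
  by (auto simp: mat_adjoint_def mat_of_rows_def)

lemma mat_adjoint_adjoint [simp]: "mat_adjoint (mat_adjoint A) = A"
  by (rule eq_matI) auto

lemma mat_adjoint_mult:
  fixes A B :: "complex mat"
  assumes "A \<in> carrier_mat m n" "B \<in> carrier_mat n l"
  shows "mat_adjoint (A * B) = mat_adjoint B * mat_adjoint A"
  using assms by (intro eq_matI) (auto simp: scalar_prod_def mult.commute)

lemma mat_adjoint_four_block_diag:
  fixes A D :: "complex mat"
  assumes "A \<in> carrier_mat m m" "D \<in> carrier_mat n n"
  shows "mat_adjoint (four_block_mat A (0\<^sub>m m n) (0\<^sub>m n m) D) =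
    four_block_mat (mat_adjoint A) (0\<^sub>m m n) (0\<^sub>m n m) (mat_adjoint D)"
  using assms by (intro eq_matI) auto

lemma mat_adjoint_one [simp]: "mat_adjoint (1\<^sub>m n :: complex mat) = 1\<^sub>m n"
  by (rule eq_matI) auto

lemma mult_four_block_diag:
  fixes A1 A2 D1 D2 :: "complex mat"
  assumes "A1 \<in> carrier_mat m m" "A2 \<in> carrier_mat m m"
    and "D1 \<in> carrier_mat n n" "D2 \<in> carrier_mat n n"
  shows "four_block_mat A1 (0\<^sub>m m n) (0\<^sub>m n m) D1 * four_block_mat A2 (0\<^sub>m m n) (0\<^sub>m n m) D2 =
    four_block_mat (A1 * A2) (0\<^sub>m m n) (0\<^sub>m n m) (D1 * D2)"
proof -
  have "A1 * A2 \<in> carrier_mat m m" "D1 * D2 \<in> carrier_mat n n" using assms by auto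
  then show ?thesis
    using assms mult_four_block_mat[OF assms(1) zero_carrier_mat zero_carrier_mat assms(3)
        assms(2) zero_carrier_mat zero_carrier_mat assms(4)]
    by simp
qed

lemma cscalar_prod_sum:
  fixes v w :: "complex vec"
  assumes "w \<in> carrier_vec n"
  shows "v \<bullet>c w = (\<Sum>i<n. v $ i * cnj (w $ i))"
  using assms by (auto simp: scalar_prod_def lessThan_atLeast0)

lemma cscalar_prod_adjoint:
  fixes A :: "complex mat"
  assumes A: "A \<in> carrier_mat m n" and v: "v \<in> carrier_vec n" and w: "w \<in> carrier_vec m"
  shows "(A *\<^sub>v v) \<bullet>c w = v \<bullet>c (mat_adjoint A *\<^sub>v w)"
proof -
  have "(A *\<^sub>v v) \<bullet>c w = (\<Sum>i<m. \<Sum>j<n. A $$ (i, j) * v $ j * cnj (w $ i))"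
    using assms by (auto simp: scalar_prod_def lessThan_atLeast0 sum_distrib_right intro!: sum.cong)
  also have "\<dots> = (\<Sum>j<n. \<Sum>i<m. A $$ (i, j) * v $ j * cnj (w $ i))"
    by (rule sum.swap)
  also have "\<dots> = v \<bullet>c (mat_adjoint A *\<^sub>v w)"
    using assms
    by (auto simp: scalar_prod_def lessThan_atLeast0 sum_distrib_left mult_ac intro!: sum.cong)
  finally show ?thesis .
qed

text \<open>No order is imposed on \<open>d\<close>, so one \<open>U\<close> also serves for
  functions of the matrix: the same eigenvectors with \<open>d\<close> replaced by other
  values.\<close>

definition unitarily_diagonalizes ::
  "nat \<Rightarrow> complex mat \<Rightarrow> (nat \<Rightarrow> real) \<Rightarrow> complex mat \<Rightarrow> bool" where
  "unitarily_diagonalizes n U d A \<longleftrightarrow> U \<in> carrier_mat n n \<and> mat_adjoint U * U = 1\<^sub>m n \<and>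
     A = U * mat_diag n (\<lambda>i. complex_of_real (d i)) * mat_adjoint U"

text \<open>Gram-Schmidt on a basis that starts with \<open>v\<close> keeps \<open>v\<close> in
  front; normalizing the columns leaves a multiple of \<open>v\<close>. The scalar stays unspecified
  because an eigenvector may be rescaled freely.\<close>

lemma orthonormal_completion:
  assumes v: "v \<in> carrier_vec n" and v0: "v \<noteq> 0\<^sub>v n"
  obtains W :: "complex mat" and c where "W \<in> carrier_mat n n" "mat_adjoint W * W = 1\<^sub>m n"
    "col W 0 = c \<cdot>\<^sub>v v"
proof -
  have n0: "n > 0" using v v0 by (cases n) auto
  define b where "b = basis_completion v"
  define ws where "ws = gram_schmidt n b"
  interpret cof_vec_space n "TYPE(complex)" .
  from basis_completion[OF v v0, folded b_def]
  have dist_b: "distinct b" and indep: "\<not> lin_dep (set b)" and b: "set b \<subseteq> carrier_vec n"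
    and hdb: "hd b = v" and len_b: "length b = n" by auto
  from hdb len_b n0 obtain vs where bv: "b = v # vs" by (cases b) auto
  from gram_schmidt_result[OF b dist_b indep refl, folded ws_def]
  have ws: "set ws \<subseteq> carrier_vec n" "corthogonal ws" "length ws = n"
    by (auto simp: len_b)
  from gram_schmidt_hd[OF v, of vs, folded bv] have hdws: "hd ws = v" unfolding ws_def .
  have ws0: "ws ! 0 = v" using hdws ws(3) n0 by (cases ws) auto
  \<comment> \<open>Gram-Schmidt here yields orthogonal vectors only; \<open>s j\<close> is the
    squared norm by which column \<open>j\<close> of \<open>W\<close> is normalized.\<close>
  define s where "s j = (\<Sum>i<n. (cmod (ws ! j $ i))\<^sup>2)" for j
  have wsc: "ws ! j \<in> carrier_vec n" if "j < n" for j
    using ws that by auto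
  have self: "ws ! j \<bullet>c ws ! j = complex_of_real (s j)" if "j < n" for j
    unfolding cscalar_prod_sum[OF wsc[OF that]] s_def by (simp flip: complex_norm_square)
  have s_nonneg: "s j \<ge> 0" for j unfolding s_def by (intro sum_nonneg) auto
  have s_pos: "s j > 0" if "j < n" for j
    using corthogonalD[OF ws(2), of j j] self[OF that] that ws(3) s_nonneg[of j] by force
  define W where "W = mat n n (\<lambda>(i, j). ws ! j $ i / complex_of_real (sqrt (s j)))"
  have W: "W \<in> carrier_mat n n" unfolding W_def by simp
  have "mat_adjoint W * W = 1\<^sub>m n"
  proof (rule eq_matI)
    fix i j assume "i < dim_row (1\<^sub>m n :: complex mat)" "j < dim_col (1\<^sub>m n :: complex mat)"
    then have ij: "i < n" "j < n" by auto
    have "(mat_adjoint W * W) $$ (i, j) =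
        (\<Sum>k<n. ws ! j $ k * cnj (ws ! i $ k)) / (complex_of_real (sqrt (s i)) * complex_of_real (sqrt (s j)))"
      using ij unfolding W_def
      by (simp add: scalar_prod_def lessThan_atLeast0 sum_divide_distrib mult_ac)
    also have "(\<Sum>k<n. ws ! j $ k * cnj (ws ! i $ k)) = ws ! j \<bullet>c ws ! i"
      using cscalar_prod_sum[OF wsc[OF ij(1)]] by simp
    also have "\<dots> / (complex_of_real (sqrt (s i)) * complex_of_real (sqrt (s j)))
        = (if i = j then 1 else 0)"
    proof (cases "i = j")
      case True
      then show ?thesis using self[OF ij(1)] s_pos[OF ij(1)]
        by (simp flip: of_real_mult)
    next
      case False
      then show ?thesis using corthogonalD[OF ws(2), of j i] ij ws(3) by auto
    qed
    finally show "(mat_adjoint W * W) $$ (i, j) = 1\<^sub>m n $$ (i, j)" using ij by simp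
  qed (use W in auto)
  moreover have "col W 0 = (1 / complex_of_real (sqrt (s 0))) \<cdot>\<^sub>v v"
    using n0 v ws0 unfolding W_def by (intro eq_vecI) auto
  ultimately show thesis using that W by blast
qed

lemma four_block_diag_index:
  fixes X :: "'a :: zero mat"
  assumes "X \<in> carrier_mat (Suc m) (Suc m)" "X $$ (0, 0) = e"
    and "\<And>i. i < m \<Longrightarrow> X $$ (Suc i, 0) = 0" "\<And>i. i < m \<Longrightarrow> X $$ (0, Suc i) = 0"
  shows "X = four_block_mat (mat 1 1 (\<lambda>_. e)) (0\<^sub>m 1 m) (0\<^sub>m m 1)
    (mat m m (\<lambda>(i, j). X $$ (Suc i, Suc j)))"
  using assms by (intro eq_matI) (auto simp: less_Suc_eq_0_disj)

text \<open>Deflation, by induction on the list of roots: in an orthonormal basis starting with an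
  eigenvector for \<open>e\<close> the first column of \<open>A\<close> is zero below
  \<open>e\<close>, hence so is the first row right of it, and the remaining block is hermitian with
  roots \<open>es\<close>. The diagonal follows the order of the given list, so any ordering of the
  roots can be realized.\<close>

theorem hermitian_unitarily_diagonalizable:
  assumes "A \<in> carrier_mat n n" "mat_adjoint A = A" "char_poly A = (\<Prod>e\<leftarrow>es. [:- e, 1:])"
  shows "length es = n \<and> (\<forall>e\<in>set es. Im e = 0) \<and> (\<exists>U. unitarily_diagonalizes n U (\<lambda>i. Re (es ! i)) A)"
  using assms
proof (induction es arbitrary: n A)
  case Nil
  then have "n = 0" using degree_monic_char_poly[of A n] by auto
  then show ?case using Nil
    by (auto simp: unitarily_diagonalizes_def intro!: exI[of _ "1\<^sub>m 0"] eq_matI)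
next
  case (Cons e es n A)
  note A = Cons.prems(1) and herm = Cons.prems(2)
  have cp: "char_poly A = [: -e, 1 :] * (\<Prod>e \<leftarrow> es. [:- e, 1:])" using Cons.prems(3) by simp
  have mon: "monic (\<Prod>e\<leftarrow> es. [:- e, 1:])" by (rule monic_prod_list) auto
  have "degree (char_poly A) = Suc (degree (\<Prod>e\<leftarrow> es. [:- e, 1:]))" unfolding cp
    by (subst degree_mult_eq) (use mon in auto)
  with degree_monic_char_poly[OF A] obtain m where n: "n = Suc m" by (cases n) auto
  have "eigenvalue A e" unfolding eigenvalue_root_char_poly[OF A] cp by simp
  then obtain v where v: "v \<in> carrier_vec n" "v \<noteq> 0\<^sub>v n" "A *\<^sub>v v = e \<cdot>\<^sub>v v"
    using A unfolding eigenvalue_def eigenvector_def by auto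
  from orthonormal_completion[OF v(1,2)] obtain W c
    where W: "W \<in> carrier_mat n n" and WW: "mat_adjoint W * W = 1\<^sub>m n"
      and col0: "col W 0 = c \<cdot>\<^sub>v v" by metis
  have W': "mat_adjoint W \<in> carrier_mat n n" using W by simp
  have WW': "W * mat_adjoint W = 1\<^sub>m n" using mat_mult_left_right_inverse[OF W' W WW] .
  \<comment> \<open>\<open>X\<close> is \<open>A\<close> written in the orthonormal basis
    \<open>W\<close>.\<close>
  define X where "X = mat_adjoint W * (A * W)"
  have X: "X \<in> carrier_mat n n"
    unfolding X_def using mult_carrier_mat[OF W' mult_carrier_mat[OF A W]] .
  have hX: "mat_adjoint X = X" using A W herm unfolding X_def
    by (simp add: mat_adjoint_mult[of _ n n _ n] assoc_mult_mat[of _ n n _ n _ n] mult_carrier_mat[of _ n n _ n])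
  have AX: "A = W * X * mat_adjoint W"
  proof -
    have "W * X * mat_adjoint W = (W * mat_adjoint W) * A * (W * mat_adjoint W)"
      using A W W' unfolding X_def by (simp add: assoc_mult_mat[of _ n n _ n _ n] mult_carrier_mat[of _ n n _ n])
    then show ?thesis unfolding WW' using A by simp
  qed
  have "col X 0 = e \<cdot>\<^sub>v unit_vec n 0"
  proof -
    have "col (A * W) 0 = A *\<^sub>v (c \<cdot>\<^sub>v v)" using A W n col0 col_mult2[of A n n W n 0] by simp
    also have "\<dots> = e \<cdot>\<^sub>v (c \<cdot>\<^sub>v v)" using A v
      by (simp add: mult_mat_vec smult_smult_assoc mult.commute)
    finally have AW0: "col (A * W) 0 = e \<cdot>\<^sub>v col W 0" unfolding col0 .
    have "0 < n" using n by simp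
    then have "col X 0 = mat_adjoint W *\<^sub>v (e \<cdot>\<^sub>v col W 0)"
      unfolding X_def AW0[symmetric] by (rule col_mult2[OF W' mult_carrier_mat[OF A W]])
    also have "\<dots> = e \<cdot>\<^sub>v (mat_adjoint W *\<^sub>v col W 0)"
      by (rule mult_mat_vec[OF W' col_carrier_vec[OF \<open>0 < n\<close> W]])
    also have "mat_adjoint W *\<^sub>v col W 0 = col (mat_adjoint W * W) 0"
      using col_mult2[OF W' W \<open>0 < n\<close>] ..
    finally show ?thesis unfolding WW using n by simp
  qed
  then have colX_index: "col X 0 $ i = (e \<cdot>\<^sub>v unit_vec n 0) $ i" for i by (rule arg_cong)
  have colX: "X $$ (i, 0) = (if i = 0 then e else 0)" if "i < n" for i
    using colX_index[of i] X that by simp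
  have hX_index: "cnj (X $$ (j, i)) = X $$ (i, j)" if "i < n" "j < n" for i j
    using mat_adjoint_index[of i X j] hX X that by simp
  \<comment> \<open>\<open>e\<close> is a diagonal entry of the hermitian matrix
    \<open>X\<close>.\<close>
  have e: "Im e = 0" using hX_index[of 0 0] colX[of 0] n by (auto simp: complex_eq_iff)
  define Y where "Y = mat m m (\<lambda>(i, j). X $$ (Suc i, Suc j))"
  have Y: "Y \<in> carrier_mat m m" unfolding Y_def by simp
  have hY: "mat_adjoint Y = Y" unfolding Y_def using hX_index n by (intro eq_matI) auto
  let ?E = "mat 1 1 (\<lambda>_. e)"
  have E: "?E \<in> carrier_mat 1 1" by simp
  have XY: "X = four_block_mat ?E (0\<^sub>m 1 m) (0\<^sub>m m 1) Y"
    unfolding Y_def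
  proof (rule four_block_diag_index)
    fix i assume "i < m"
    then show "X $$ (Suc i, 0) = 0" "X $$ (0, Suc i) = 0"
      using hX_index[of 0 "Suc i"] colX[of "Suc i"] n by auto
  qed (use X n colX[of 0] in auto)
  have "similar_mat A X"
    by (rule similar_matI[of _ _ W "mat_adjoint W" n]) (use A X W W' WW WW' AX in \<open>simp_all only: insert_subset empty_subsetI\<close>)
  then have "char_poly A = char_poly X" by (rule char_poly_similar)
  also have "\<dots> = char_poly ?E * char_poly Y"
    unfolding XY by (rule char_poly_four_block_zeros_col[OF E _ Y]) auto
  also have "char_poly ?E = [: -e,1 :]"
    by (simp add: char_poly_defs det_def sign_def)
  \<comment> \<open>Cancelling the factor of \<open>e\<close> leaves exactly the roots
    \<open>es\<close> for the smaller block.\<close>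
  finally have "char_poly Y = (\<Prod> e \<leftarrow> es. [:- e, 1:])" unfolding cp
    by (metis mult_cancel_left pCons_eq_0_iff zero_neq_one)
  from Cons.IH[OF Y hY this] obtain V
    where len: "length es = m" and re: "\<forall>e\<in>set es. Im e = 0"
      and V: "V \<in> carrier_mat m m" "mat_adjoint V * V = 1\<^sub>m m"
      and YV: "Y = V * mat_diag m (\<lambda>i. complex_of_real (Re (es ! i))) * mat_adjoint V"
    unfolding unitarily_diagonalizes_def by auto
  \<comment> \<open>\<open>F\<close> fixes the first basis vector and diagonalizes the block
    \<open>Y\<close>, so \<open>W * F\<close> diagonalizes \<open>A\<close>.\<close>
  define F where "F = four_block_mat (1\<^sub>m 1) (0\<^sub>m 1 m) (0\<^sub>m m 1) V"
  let ?D = "mat_diag n (\<lambda>i. complex_of_real (Re ((e # es) ! i)))"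
  let ?D' = "mat_diag m (\<lambda>i. complex_of_real (Re (es ! i)))"
  have F: "F \<in> carrier_mat n n" unfolding F_def n using V by auto
  have one: "1\<^sub>m 1 \<in> carrier_mat 1 (1::nat)" by simp
  have V': "mat_adjoint V \<in> carrier_mat m m" using V by simp
  have D': "?D' \<in> carrier_mat m m" by simp
  have VD: "V * ?D' \<in> carrier_mat m m" using mult_carrier_mat[OF V(1) D'] .
  have F': "mat_adjoint F = four_block_mat (1\<^sub>m 1) (0\<^sub>m 1 m) (0\<^sub>m m 1) (mat_adjoint V)"
    unfolding F_def mat_adjoint_four_block_diag[OF one V(1)] mat_adjoint_one ..
  have FF: "mat_adjoint F * F = 1\<^sub>m n"
    unfolding F' unfolding F_def mult_four_block_diag[OF one one V' V(1)] V(2) n by simp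
  have D: "?D = four_block_mat ?E (0\<^sub>m 1 m) (0\<^sub>m m 1) ?D'"
    unfolding n using e
    by (intro eq_matI) (auto simp: mat_diag_def less_Suc_eq_0_disj complex_eq_iff)
  have XF: "X = F * ?D * mat_adjoint F"
    unfolding F' XY YV unfolding F_def D mult_four_block_diag[OF one E V(1) D']
      left_mult_one_mat[OF E] mult_four_block_diag[OF E one VD V'] right_mult_one_mat[OF E] ..
  have "mat_adjoint (W * F) * (W * F) = mat_adjoint F * (mat_adjoint W * W) * F"
    using W F W' by (simp add: mat_adjoint_mult[of _ n n _ n] assoc_mult_mat[of _ n n _ n _ n] mult_carrier_mat[of _ n n _ n])
  then have 1: "mat_adjoint (W * F) * (W * F) = 1\<^sub>m n" unfolding WW using F FF by simp
  have 2: "A = (W * F) * ?D * mat_adjoint (W * F)"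
    unfolding AX XF using W F W' by (simp add: mat_adjoint_mult[of _ n n _ n] assoc_mult_mat[of _ n n _ n _ n] mult_carrier_mat[of _ n n _ n])
  show ?case using len re e n W F 1 2
    unfolding unitarily_diagonalizes_def by (auto intro!: exI[of _ "W * F"])
qed

section \<open>Norm, quadratic form and trace in an eigenbasis\<close>

lemma unitarily_diagonalizesD:
  assumes "unitarily_diagonalizes n U d A"
  shows "U \<in> carrier_mat n n" "mat_adjoint U \<in> carrier_mat n n"
    "mat_adjoint U * U = 1\<^sub>m n" "U * mat_adjoint U = 1\<^sub>m n"
    "A = U * mat_diag n (\<lambda>i. complex_of_real (d i)) * mat_adjoint U" "A \<in> carrier_mat n n"
proof -
  show U: "U \<in> carrier_mat n n" and UU: "mat_adjoint U * U = 1\<^sub>m n"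
    and A: "A = U * mat_diag n (\<lambda>i. complex_of_real (d i)) * mat_adjoint U"
    using assms by (auto simp: unitarily_diagonalizes_def)
  show U': "mat_adjoint U \<in> carrier_mat n n" using U by simp
  show "U * mat_adjoint U = 1\<^sub>m n" by (rule mat_mult_left_right_inverse[OF U' U UU])
  show "A \<in> carrier_mat n n"
    unfolding A by (rule mult_carrier_mat[OF mult_carrier_mat[OF U mat_diag_dim] U'])
qed

text \<open>Parseval's identity: \<open>mat_adjoint U *\<^sub>v x\<close> lists the coordinates of
  \<open>x\<close> in the orthonormal basis of the columns of \<open>U\<close>.\<close>

lemma unitarily_diagonalizes_norm:
  assumes UA: "unitarily_diagonalizes n U d A" and x: "x \<in> carrier_vec n"
  shows "Re (x \<bullet>c x) = (\<Sum>i<n. (cmod ((mat_adjoint U *\<^sub>v x) $ i))\<^sup>2)"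
proof -
  note U = unitarily_diagonalizesD[OF UA]
  define y where "y = mat_adjoint U *\<^sub>v x"
  have y: "y \<in> carrier_vec n" unfolding y_def using U(2) x by (rule mult_mat_vec_carrier)
  have "x = U *\<^sub>v y"
    unfolding y_def assoc_mult_mat_vec[OF U(1,2) x, symmetric] U(4) using x by simp
  then have "x \<bullet>c x = (U *\<^sub>v y) \<bullet>c x" by simp
  also have "\<dots> = y \<bullet>c y" unfolding cscalar_prod_adjoint[OF U(1) y x] y_def[symmetric] ..
  finally show ?thesis unfolding y_def[symmetric] cscalar_prod_sum[OF y]
    by (simp flip: complex_norm_square of_real_power)
qed

lemma unitarily_diagonalizes_quadratic_form:
  assumes UA: "unitarily_diagonalizes n U d A" and x: "x \<in> carrier_vec n"
  shows "Re ((A *\<^sub>v x) \<bullet>c x) = (\<Sum>i<n. d i * (cmod ((mat_adjoint U *\<^sub>v x) $ i))\<^sup>2)"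
proof -
  note U = unitarily_diagonalizesD[OF UA]
  let ?D = "mat_diag n (\<lambda>i. complex_of_real (d i))"
  define y where "y = mat_adjoint U *\<^sub>v x"
  have y: "y \<in> carrier_vec n" unfolding y_def using U(2) x by (rule mult_mat_vec_carrier)
  have Dy: "?D *\<^sub>v y \<in> carrier_vec n" using mat_diag_dim y by (rule mult_mat_vec_carrier)
  have Dyi: "(?D *\<^sub>v y) $ i = complex_of_real (d i) * y $ i" if "i < n" for i
  proof -
    have "(?D *\<^sub>v y) $ i = (\<Sum>j<n. (if i = j then complex_of_real (d j) else 0) * y $ j)"
      using that y by (simp add: mat_diag_def scalar_prod_def lessThan_atLeast0)
    also have "\<dots> = (\<Sum>j<n. if i = j then complex_of_real (d j) * y $ j else 0)"
      by (rule sum.cong) auto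
    finally show ?thesis using that by simp
  qed
  have "A *\<^sub>v x = U *\<^sub>v (?D *\<^sub>v y)"
    unfolding U(5) y_def
    using assoc_mult_mat_vec[OF mult_carrier_mat[OF U(1) mat_diag_dim] U(2) x]
      assoc_mult_mat_vec[OF U(1) mat_diag_dim y[unfolded y_def]] by metis
  then have "(A *\<^sub>v x) \<bullet>c x = (?D *\<^sub>v y) \<bullet>c y"
    using cscalar_prod_adjoint[OF U(1) Dy x] y_def by simp
  also have "\<dots> = (\<Sum>i<n. complex_of_real (d i * (cmod (y $ i))\<^sup>2))"
    unfolding cscalar_prod_sum[OF y]
    by (rule sum.cong) (auto simp: Dyi complex_norm_square simp del: of_real_power)
  finally show ?thesis unfolding y_def[symmetric] by simp
qed

text \<open>Each diagonal entry of \<open>A\<close> is a combination of the \<open>d k\<close> with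
  weights \<open>|U(i, k)|^2\<close>; for fixed \<open>k\<close> these weights sum to 1, since
  column \<open>k\<close> of \<open>U\<close> is a unit vector.\<close>

lemma unitarily_diagonalizes_trace:
  assumes UA: "unitarily_diagonalizes n U d A"
  shows "(\<Sum>i<n. Re (A $$ (i, i))) = (\<Sum>i<n. d i)"
proof -
  note U = unitarily_diagonalizesD[OF UA]
  let ?D = "mat_diag n (\<lambda>i. complex_of_real (d i))"
  have UD: "U * ?D = mat n n (\<lambda>(i, j). U $$ (i, j) * complex_of_real (d j))"
    by (rule mat_diag_mult_right[OF U(1)])
  have "A $$ (i, i) = (\<Sum>k<n. complex_of_real (d k * (cmod (U $$ (i, k)))\<^sup>2))" if "i < n" for i
  proof -
    have "A $$ (i, i) = (\<Sum>k<n. U $$ (i, k) * complex_of_real (d k) * cnj (U $$ (i, k)))"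
      unfolding U(5) UD using U(1) that by (simp add: scalar_prod_def lessThan_atLeast0)
    then show ?thesis by (auto simp: complex_norm_square simp del: of_real_power intro!: sum.cong)
  qed
  then have "(\<Sum>i<n. Re (A $$ (i, i))) = (\<Sum>i<n. \<Sum>k<n. d k * (cmod (U $$ (i, k)))\<^sup>2)"
    by simp
  also have "\<dots> = (\<Sum>k<n. d k * (\<Sum>i<n. (cmod (U $$ (i, k)))\<^sup>2))"
    by (subst sum.swap) (simp add: sum_distrib_left)
  also have "\<dots> = (\<Sum>k<n. d k)"
  proof (rule sum.cong)
    fix k assume "k \<in> {..<n}"
    then have k: "k < n" by simp
    have "1 = (mat_adjoint U * U) $$ (k, k)" unfolding U(3) using k by simp
    also have "\<dots> = (\<Sum>i<n. cnj (U $$ (i, k)) * U $$ (i, k))"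
      using U(1) k by (simp add: scalar_prod_def lessThan_atLeast0)
    also have "\<dots> = complex_of_real (\<Sum>i<n. (cmod (U $$ (i, k)))\<^sup>2)"
      by (simp add: complex_norm_square mult.commute del: of_real_power)
    finally show "d k * (\<Sum>i<n. (cmod (U $$ (i, k)))\<^sup>2) = d k"
      by (metis mult.right_neutral of_real_eq_1_iff)
  qed simp
  finally show ?thesis .
qed

section \<open>Eigenvalue inequalities\<close>

text \<open>The test vector lies in the span of the first \<open>m + 1\<close> eigenvectors of \<open>A\<close> and is orthogonal
  to the first \<open>m\<close> eigenvectors of \<open>B\<close>: these are \<open>n - 1\<close> homogeneous equations, encoded by a
  square matrix whose row \<open>m\<close> vanishes.\<close>

lemma weyl_monotonicity:
  assumes UA: "unitarily_diagonalizes n U d A" and VB: "unitarily_diagonalizes n V e B"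
    and d: "antimono_on {..<n} d" and e: "antimono_on {..<n} e"
    and le: "\<And>x. x \<in> carrier_vec n \<Longrightarrow>
      Re ((A *\<^sub>v x) \<bullet>c x) + c * Re (x \<bullet>c x) \<le> Re ((B *\<^sub>v x) \<bullet>c x)"
    and m: "m < n"
  shows "d m + c \<le> e m"
proof -
  note U = unitarily_diagonalizesD[OF UA] and V = unitarily_diagonalizesD[OF VB]
  define M where "M = mat n n (\<lambda>(i, j). if i < m then mat_adjoint V $$ (i, j)
    else if i = m then 0 else mat_adjoint U $$ (i, j))"
  have M: "M \<in> carrier_mat n n" unfolding M_def by simp
  have "M = mat\<^sub>r n n (\<lambda>i. if i = m then 0\<^sub>v n else row M i)"
    using M by (intro eq_matI) (auto simp: M_def)
  then have "det M = 0" using det_row_0[OF m, of "row M"] M by force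
  then obtain x where x: "x \<in> carrier_vec n" "x \<noteq> 0\<^sub>v n" "M *\<^sub>v x = 0\<^sub>v n"
    using det_0_iff_vec_prod_zero[OF M] by auto
  define y where "y = mat_adjoint U *\<^sub>v x"
  define z where "z = mat_adjoint V *\<^sub>v x"
  have Mx: "(\<Sum>j<n. M $$ (i, j) * x $ j) = 0" if "i < n" for i
  proof -
    have "(M *\<^sub>v x) $ i = 0" unfolding x(3) using that by simp
    then show ?thesis using that M x(1) by (simp add: scalar_prod_def lessThan_atLeast0)
  qed
  have z: "z $ i = 0" if "i < m" for i
    using Mx[of i] that m V(1) x(1)
    by (simp add: M_def z_def scalar_prod_def lessThan_atLeast0)
  have y: "y $ i = 0" if "i < n" "i > m" for i
    using Mx[of i] that m U(1) x(1)
    by (simp add: M_def y_def scalar_prod_def lessThan_atLeast0)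
  \<comment> \<open>\<open>y\<close> is supported on indices up to \<open>m\<close>, where
    \<open>d i\<close> is at least \<open>d m\<close>. Dually, \<open>z\<close> is supported on
    indices from \<open>m\<close> on, where \<open>e i\<close> is at most
    \<open>e m\<close>.\<close>
  have "d m * Re (x \<bullet>c x) \<le> Re ((A *\<^sub>v x) \<bullet>c x)"
    unfolding unitarily_diagonalizes_norm[OF UA x(1)]
      unitarily_diagonalizes_quadratic_form[OF UA x(1)] y_def[symmetric] sum_distrib_left
  proof (rule sum_mono)
    fix i assume "i \<in> {..<n}"
    then show "d m * (cmod (y $ i))\<^sup>2 \<le> d i * (cmod (y $ i))\<^sup>2"
      using y[of i] m monotone_onD[OF d, of i m] by (cases "i \<le> m") (auto intro!: mult_right_mono)
  qed
  moreover have "Re ((B *\<^sub>v x) \<bullet>c x) \<le> e m * Re (x \<bullet>c x)"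
    unfolding unitarily_diagonalizes_norm[OF VB x(1)]
      unitarily_diagonalizes_quadratic_form[OF VB x(1)] z_def[symmetric] sum_distrib_left
  proof (rule sum_mono)
    fix i assume "i \<in> {..<n}"
    then show "e i * (cmod (z $ i))\<^sup>2 \<le> e m * (cmod (z $ i))\<^sup>2"
      using z[of i] m monotone_onD[OF e, of m i] by (cases "m \<le> i") (auto intro!: mult_right_mono)
  qed
  ultimately have "(d m + c) * Re (x \<bullet>c x) \<le> e m * Re (x \<bullet>c x)"
    using le[OF x(1)] by (simp add: algebra_simps)
  moreover have "Re (x \<bullet>c x) > 0"
    using conjugate_square_greater_0_vec[OF x(1)] x(2) by (auto simp: less_complex_def)
  ultimately show ?thesis by simp
qed

text \<open>Links the sorted list of real parts of roots with the spectral theorem, which is used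
  twice: first for an arbitrary factorization, to see that the roots are real, then for the sorted
  list.\<close>

lemma hermitian_eigenvalues_desc:
  assumes A: "A \<in> carrier_mat n n" and "hermitian_mat A"
  shows "length (eigenvalues_desc A) = n" "antimono_on {..<n} ((!) (eigenvalues_desc A))"
    "\<exists>U. unitarily_diagonalizes n U ((!) (eigenvalues_desc A)) A"
proof -
  have herm: "mat_adjoint A = A" using assms(2) by (simp add: hermitian_mat_def)
  let ?es = "eigenvalues_desc A"
  let ?cs = "map complex_of_real ?es"
  obtain as where as: "char_poly A = (\<Prod>a\<leftarrow>as. [:- a, 1:])"
    using char_poly_factorized[OF A] by blast
  have real_roots: "\<forall>a\<in>set as. Im a = 0" using hermitian_unitarily_diagonalizable[OF A herm as] by simp
  have "proots (\<Prod>b\<leftarrow>bs. [:- b, 1:]) = mset bs" for bs :: "complex list"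
  proof (induction bs)
    case (Cons b bs)
    have "(\<Prod>b\<leftarrow>bs. [:- b, 1:]) \<noteq> 0" by (auto simp: prod_list_zero_iff)
    then have "proots ([:- b, 1:] * (\<Prod>b\<leftarrow>bs. [:- b, 1:])) =
        proots [:- b, 1:] + proots (\<Prod>b\<leftarrow>bs. [:- b, 1:])"
      by (intro proots_mult) simp
    then show ?case using Cons by (simp del: mult_pCons_left)
  qed simp
  then have proots: "proots (char_poly A) = mset as" unfolding as .
  have "mset ?es = image_mset Re (mset as)"
    unfolding eigenvalues_desc_def proots by simp
  then have "mset ?cs = image_mset (\<lambda>a. complex_of_real (Re a)) (mset as)"
    by (simp add: multiset.map_comp comp_def)
  also have "\<dots> = mset as"
    using real_roots by (subst image_mset_cong[of _ _ "\<lambda>a. a"]) (auto simp: complex_eq_iff)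
  finally have "mset ?cs = mset as" .
  then have "mset (map (\<lambda>a. [:- a, 1:]) ?cs) = mset (map (\<lambda>a. [:- a, 1:]) as)"
    by (metis mset_map)
  \<comment> \<open>The product depends only on the multiset of roots, so the factorization may
    follow the decreasing order.\<close>
  then have "char_poly A = (\<Prod>a\<leftarrow>?cs. [:- a, 1:])"
    unfolding as by (metis prod_mset_prod_list)
  from hermitian_unitarily_diagonalizable[OF A herm this]
  obtain U where len: "length ?es = n" and U: "unitarily_diagonalizes n U (\<lambda>i. Re (?cs ! i)) A"
    by auto
  show "length ?es = n" by (rule len)
  have "mat_diag n (\<lambda>i. complex_of_real (Re (?cs ! i))) = mat_diag n (\<lambda>i. complex_of_real (?es ! i))"
    using len by (intro eq_matI) (auto simp: mat_diag_def)
  then show "\<exists>U. unitarily_diagonalizes n U ((!) ?es) A"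
    using U unfolding unitarily_diagonalizes_def by auto
  have "sorted (rev ?es)" unfolding eigenvalues_desc_def by simp
  then show "antimono_on {..<n} ((!) ?es)"
    using len by (auto simp: monotone_on_def sorted_rev_nth_mono)
qed

lemma hermitian_unitary_conjugate:
  fixes U :: "complex mat" and d :: "nat \<Rightarrow> real"
  assumes U: "U \<in> carrier_mat n n"
  defines "P \<equiv> U * mat_diag n (\<lambda>i. complex_of_real (d i)) * mat_adjoint U"
  shows "mat_adjoint P = P"
proof -
  have U': "mat_adjoint U \<in> carrier_mat n n" using U by simp
  have D: "mat_adjoint (mat_diag n (\<lambda>i. complex_of_real (d i))) = mat_diag n (\<lambda>i. complex_of_real (d i))"
    by (rule eq_matI) (auto simp: mat_diag_def)
  show ?thesis
    unfolding P_def mat_adjoint_mult[OF mult_carrier_mat[OF U mat_diag_dim] U']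
      mat_adjoint_mult[OF U mat_diag_dim] D mat_adjoint_adjoint
    by (rule assoc_mult_mat[OF U mat_diag_dim U', symmetric])
qed

lemma mat_adjoint_add:
  fixes A B :: "complex mat"
  assumes "A \<in> carrier_mat m n" "B \<in> carrier_mat m n"
  shows "mat_adjoint (A + B) = mat_adjoint A + mat_adjoint B"
  using assms by (intro eq_matI) auto

lemma mat_adjoint_minus:
  fixes A B :: "complex mat"
  assumes "A \<in> carrier_mat m n" "B \<in> carrier_mat m n"
  shows "mat_adjoint (A - B) = mat_adjoint A - mat_adjoint B"
  using assms by (intro eq_matI) auto

lemma quadratic_form_add:
  fixes A B :: "complex mat"
  assumes "A \<in> carrier_mat n n" "B \<in> carrier_mat n n" "x \<in> carrier_vec n"
  shows "Re (((A + B) *\<^sub>v x) \<bullet>c x) = Re ((A *\<^sub>v x) \<bullet>c x) + Re ((B *\<^sub>v x) \<bullet>c x)"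
  using assms add_mult_distrib_mat_vec[OF assms]
    add_scalar_prod_distrib[of "A *\<^sub>v x" n "B *\<^sub>v x" "conjugate x"] by simp

lemma quadratic_form_minus:
  fixes A B :: "complex mat"
  assumes "A \<in> carrier_mat n n" "B \<in> carrier_mat n n" "x \<in> carrier_vec n"
  shows "Re (((A - B) *\<^sub>v x) \<bullet>c x) = Re ((A *\<^sub>v x) \<bullet>c x) - Re ((B *\<^sub>v x) \<bullet>c x)"
  using assms minus_mult_distrib_mat_vec[OF assms]
    minus_scalar_prod_distrib[of "A *\<^sub>v x" n "B *\<^sub>v x" "conjugate x"] by simp

lemma sum_eigenvalues_desc:
  assumes "A \<in> carrier_mat n n" "hermitian_mat A"
  shows "(\<Sum>i<n. eigenvalues_desc A ! i) = (\<Sum>i<n. Re (A $$ (i, i)))"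
  using hermitian_eigenvalues_desc(3)[OF assms] unitarily_diagonalizes_trace by metis

text \<open>The hypothesis is \<open>A + c I \<le> B\<close> in the Loewner order. The shift
  \<open>c\<close> allows a comparison with a multiple of the identity added.\<close>

lemma eigenvalues_desc_mono:
  assumes "A \<in> carrier_mat n n" "hermitian_mat A" "B \<in> carrier_mat n n" "hermitian_mat B"
    and "\<And>x. x \<in> carrier_vec n \<Longrightarrow>
      Re ((A *\<^sub>v x) \<bullet>c x) + c * Re (x \<bullet>c x) \<le> Re ((B *\<^sub>v x) \<bullet>c x)"
    and "i < n"
  shows "eigenvalues_desc A ! i + c \<le> eigenvalues_desc B ! i"
  using assms hermitian_eigenvalues_desc weyl_monotonicity by metis

text \<open>With \<open>\<beta>\<close> the \<open>s\<close>-th smallest eigenvalue of \<open>B\<close> and \<open>P = (\<beta> - B)\<^sup>+\<close> we have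
  \<open>A + B \<ge> A - P + \<beta>\<close>. Passing from \<open>A\<close> to \<open>A - P\<close> decreases every eigenvalue, and all of them
  together by the trace of \<open>P\<close>.\<close>

theorem lidskii:
  assumes A: "A \<in> carrier_mat n n" "hermitian_mat A" and B: "B \<in> carrier_mat n n" "hermitian_mat B"
    and S: "S \<subseteq> {..<n}"
  shows "(\<Sum>r<card S. eigenvalues_desc B ! (n - 1 - r)) \<le>
    (\<Sum>i\<in>S. eigenvalues_desc (A + B) ! i - eigenvalues_desc A ! i)"
proof (cases "S = {}")
  case False
  define s where "s = card S"
  have finS: "finite S" using S finite_subset by blast
  have s: "0 < s" "s \<le> n"
    using False finS card_mono[OF _ S] by (auto simp: s_def card_gt_0_iff)
  define e where "e = (!) (eigenvalues_desc B)"
  obtain V where V: "unitarily_diagonalizes n V e B"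
    using hermitian_eigenvalues_desc(3)[OF B] unfolding e_def by blast
  have e: "antimono_on {..<n} e" using hermitian_eigenvalues_desc(2)[OF B] unfolding e_def .
  \<comment> \<open>Indices are 0-based and decreasing, so \<open>n - s\<close> is the position of
    the \<open>s\<close>-th smallest eigenvalue.\<close>
  define \<beta> where "\<beta> = e (n - s)"
  define p where "p i = max (\<beta> - e i) 0" for i
  define P where "P = V * mat_diag n (\<lambda>i. complex_of_real (p i)) * mat_adjoint V"
  have VP: "unitarily_diagonalizes n V p P"
    using V unfolding unitarily_diagonalizes_def P_def by auto
  note Pc = unitarily_diagonalizesD(6)[OF VP]
  have hP: "mat_adjoint P = P"
    unfolding P_def by (rule hermitian_unitary_conjugate[OF unitarily_diagonalizesD(1)[OF V]])
  have AP: "A - P \<in> carrier_mat n n" "hermitian_mat (A - P)"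
    using A Pc hP unfolding hermitian_mat_def by (auto simp: mat_adjoint_minus)
  have AB: "A + B \<in> carrier_mat n n" "hermitian_mat (A + B)"
    using A B unfolding hermitian_mat_def by (auto simp: mat_adjoint_add)
  have P0: "Re ((P *\<^sub>v x) \<bullet>c x) \<ge> 0" if "x \<in> carrier_vec n" for x
    unfolding unitarily_diagonalizes_quadratic_form[OF VP that] p_def by (intro sum_nonneg) auto
  have PB: "\<beta> * Re (x \<bullet>c x) - Re ((P *\<^sub>v x) \<bullet>c x) \<le> Re ((B *\<^sub>v x) \<bullet>c x)" if "x \<in> carrier_vec n" for x
    unfolding unitarily_diagonalizes_quadratic_form[OF VP that]
      unitarily_diagonalizes_quadratic_form[OF V that] unitarily_diagonalizes_norm[OF V that]
      sum_distrib_left sum_subtractf[symmetric] left_diff_distrib[symmetric]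
    by (intro sum_mono mult_right_mono) (auto simp: p_def)
  define l where "l = (!) (eigenvalues_desc A)"
  define l' where "l' = (!) (eigenvalues_desc (A - P))"
  define c where "c = (!) (eigenvalues_desc (A + B))"
  have l'c: "l' i + \<beta> \<le> c i" if "i < n" for i
    unfolding l'_def c_def
  proof (rule eigenvalues_desc_mono[OF AP AB _ that])
    fix x :: "complex vec" assume "x \<in> carrier_vec n"
    then show "Re (((A - P) *\<^sub>v x) \<bullet>c x) + \<beta> * Re (x \<bullet>c x) \<le> Re (((A + B) *\<^sub>v x) \<bullet>c x)"
      using PB[of x] by (simp add: quadratic_form_add[OF A(1) B(1)] quadratic_form_minus[OF A(1) Pc])
  qed
  have l'l: "l' i \<le> l i" if "i < n" for i
  proof -
    have "l' i + 0 \<le> l i"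
      unfolding l'_def l_def
    proof (rule eigenvalues_desc_mono[OF AP A _ that])
      fix x :: "complex vec" assume "x \<in> carrier_vec n"
      then show "Re (((A - P) *\<^sub>v x) \<bullet>c x) + 0 * Re (x \<bullet>c x) \<le> Re ((A *\<^sub>v x) \<bullet>c x)"
        using P0[of x] by (simp add: quadratic_form_minus[OF A(1) Pc])
    qed
    then show ?thesis by simp
  qed
  \<comment> \<open>Every drop \<open>l i - l' i\<close> is nonnegative, so those in
    \<open>S\<close> cost at most the total, which is the trace of \<open>P\<close>.\<close>
  have "(\<Sum>i\<in>S. l i - l' i) \<le> (\<Sum>i<n. l i - l' i)"
    by (rule sum_mono2) (use S l'l in auto)
  also have "\<dots> = (\<Sum>i<n. Re (A $$ (i, i)) - Re ((A - P) $$ (i, i)))"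
    unfolding sum_subtractf l_def l'_def sum_eigenvalues_desc[OF A] sum_eigenvalues_desc[OF AP] ..
  also have "\<dots> = (\<Sum>i<n. Re (P $$ (i, i)))" by (rule sum.cong) (use A Pc in auto)
  also have "\<dots> = (\<Sum>i<n. p i)" by (rule unitarily_diagonalizes_trace[OF VP])
  \<comment> \<open>Only the \<open>s\<close> smallest eigenvalues of \<open>B\<close> can lie below
    \<beta>; on these positions the truncation at 0 has no effect.\<close>
  also have "\<dots> = (\<Sum>i\<in>{n - s..<n}. p i)"
  proof (rule sum.mono_neutral_right)
    show "\<forall>i\<in>{..<n} - {n - s..<n}. p i = 0"
      using monotone_onD[OF e, of _ "n - s"] s by (auto simp: p_def \<beta>_def)
  qed auto
  also have "\<dots> = (\<Sum>i\<in>{n - s..<n}. \<beta> - e i)"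
    by (rule sum.cong) (use monotone_onD[OF e, of "n - s"] s in \<open>auto simp: p_def \<beta>_def\<close>)
  also have "\<dots> = (\<Sum>r<s. \<beta> - e (n - 1 - r))"
    by (rule sum.reindex_bij_witness[of _ "\<lambda>r. n - 1 - r" "\<lambda>i. n - 1 - i"]) (use s in auto)
  also have "\<dots> = s * \<beta> - (\<Sum>r<s. e (n - 1 - r))" by (simp add: sum_subtractf)
  finally have "(\<Sum>r<s. e (n - 1 - r)) \<le> s * \<beta> - (\<Sum>i\<in>S. l i - l' i)" by simp
  \<comment> \<open>As \<open>S\<close> has exactly \<open>s\<close> elements, each of them receives
    one copy of \<beta>.\<close>
  also have "\<dots> = (\<Sum>i\<in>S. l' i + \<beta> - l i)"
    by (simp add: sum_subtractf sum.distrib s_def)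
  also have "\<dots> \<le> (\<Sum>i\<in>S. c i - l i)"
    by (rule sum_mono) (use l'c S in force)
  finally show ?thesis unfolding s_def e_def c_def l_def .
qed simp

section \<open>Products of reals\<close>

lemma real_root_prod: "k > 0 \<Longrightarrow> root k (\<Prod>i\<in>I. f i) = (\<Prod>i\<in>I. root k (f i))"
  by (induction I rule: infinite_finite_induct) (auto simp: real_root_mult)

lemma arith_geom_mean_root:
  fixes x :: "'a \<Rightarrow> real"
  assumes "finite I" "I \<noteq> {}" "\<And>i. i \<in> I \<Longrightarrow> x i \<ge> 0"
  shows "root (card I) (\<Prod>i\<in>I. x i) \<le> (\<Sum>i\<in>I. x i) / card I"
proof -
  have "card I > 0" "(\<Prod>i\<in>I. x i) \<ge> 0" using assms by (auto simp: card_gt_0_iff intro: prod_nonneg)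
  \<comment> \<open>The conversion of \<open>root\<close> to \<open>powr\<close> needs a positive
    base; at 0 both sides are 0.\<close>
  then have "root (card I) (\<Prod>i\<in>I. x i) = (\<Prod>i\<in>I. x i) powr (1 / card I)"
    by (cases "(\<Prod>i\<in>I. x i) = 0") (auto simp: root_powr_inverse)
  then show ?thesis using arith_geom_mean[OF assms] by (simp add: sum_divide_distrib)
qed

text \<open>After division by the right-hand side, AM-GM bounds the two quotients by the means of
  \<open>a i / (a i + d i)\<close> and \<open>d i / (a i + d i)\<close>, which add up to 1. If some
  denominator is 0, both products on the left contain a zero factor.\<close>

lemma minkowski_prod_root:
  fixes a d :: "'a \<Rightarrow> real"
  assumes I: "finite I" "I \<noteq> {}" and k: "card I = k"
    and a: "\<And>i. i \<in> I \<Longrightarrow> a i \<ge> 0" and d: "\<And>i. i \<in> I \<Longrightarrow> d i \<ge> 0"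
  shows "(\<Prod>i\<in>I. root k (a i)) + (\<Prod>i\<in>I. root k (d i)) \<le> (\<Prod>i\<in>I. root k (a i + d i))"
proof (cases "\<exists>i\<in>I. a i + d i = 0")
  case True
  then obtain i where i: "i \<in> I" "a i + d i = 0" by blast
  then have "a i = 0" "d i = 0" using a[of i] d[of i] by auto
  then have zero: "(\<Prod>i\<in>I. root k (a i)) = 0" "(\<Prod>i\<in>I. root k (d i)) = 0"
    using I(1) i(1) by (auto intro!: prod_zero bexI[of _ i])
  have "(\<Prod>i\<in>I. root k (a i + d i)) \<ge> 0"
    by (intro prod_nonneg real_root_ge_zero add_nonneg_nonneg a d)
  then show ?thesis unfolding zero add_0_left .
next
  case False
  have k0: "k > 0" unfolding k[symmetric] card_gt_0_iff using I by simp
  have pos: "a i + d i > 0" if "i \<in> I" for i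
    using False a[OF that] d[OF that] that less_eq_real_def by fastforce
  then have Z: "(\<Prod>i\<in>I. root k (a i + d i)) > 0"
    using k0 by (intro prod_pos) auto
  have "(\<Prod>i\<in>I. root k (u i)) / (\<Prod>i\<in>I. root k (a i + d i)) \<le> (\<Sum>i\<in>I. u i / (a i + d i)) / k"
    if "\<And>i. i \<in> I \<Longrightarrow> u i \<ge> 0" for u
  proof -
    have "(\<Prod>i\<in>I. root k (u i)) / (\<Prod>i\<in>I. root k (a i + d i)) = root k (\<Prod>i\<in>I. u i / (a i + d i))"
      using k0 by (simp add: real_root_prod real_root_divide prod_dividef)
    also have "\<dots> \<le> (\<Sum>i\<in>I. u i / (a i + d i)) / k"
      using arith_geom_mean_root[of I "\<lambda>i. u i / (a i + d i)"] I that pos k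
      by (simp add: less_imp_le)
    finally show ?thesis .
  qed
  from this[of a, OF a] this[of d, OF d]
  have "((\<Prod>i\<in>I. root k (a i)) + (\<Prod>i\<in>I. root k (d i))) / (\<Prod>i\<in>I. root k (a i + d i)) \<le>
      (\<Sum>i\<in>I. a i / (a i + d i) + d i / (a i + d i)) / k"
    by (simp add: sum.distrib add_divide_distrib)
  also have "(\<Sum>i\<in>I. a i / (a i + d i) + d i / (a i + d i)) = (\<Sum>i\<in>I. 1)"
    using pos by (intro sum.cong) (force simp flip: add_divide_distrib)+
  finally show ?thesis using Z k k0 by (simp add: divide_le_eq)
qed

text \<open>Summation by parts: decreasing nonnegative weights preserve nonpositivity of partial
  sums.\<close>

lemma abel_sum_nonpos:
  fixes w x :: "nat \<Rightarrow> real"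
  assumes w: "antimono_on {..<k} w" "\<And>r. r < k \<Longrightarrow> w r \<ge> 0"
    and x: "\<And>s. s \<le> k \<Longrightarrow> (\<Sum>r<s. x r) \<le> 0"
  shows "(\<Sum>r<k. w r * x r) \<le> 0"
proof -
  \<comment> \<open>The stronger bound carries the induction: lowering the weight from
    \<open>w s\<close> to \<open>w (Suc s)\<close> can only raise its product with a nonpositive
    partial sum.\<close>
  have "(\<Sum>r<Suc s. w r * x r) \<le> w s * (\<Sum>r<Suc s. x r)" if "s < k" for s
    using that
  proof (induction s)
    case (Suc s)
    have "w s * (\<Sum>r<Suc s. x r) \<le> w (Suc s) * (\<Sum>r<Suc s. x r)"
      using x[of "Suc s"] monotone_onD[OF w(1), of s "Suc s"] Suc.prems
      by (intro mult_right_mono_neg) auto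
    then show ?case using Suc by (simp add: algebra_simps)
  qed simp
  from this[of "k - 1"] show ?thesis
    using mult_nonneg_nonpos[OF w(2)[of "k - 1"] x[of k]] by (cases k) auto
qed

text \<open>For positive \<open>f\<close>, the bound \<open>t \<le> exp (t - 1)\<close> at
  \<open>t = b r / f r\<close> reduces the claim to the sum of \<open>(b r - f r) / f r\<close>
  being nonpositive. That is Abel summation with the decreasing weights
  \<open>1 / f r\<close>.\<close>

lemma weak_supermajorization_prod_le:
  fixes b f :: "nat \<Rightarrow> real"
  assumes b: "\<And>r. r < k \<Longrightarrow> b r \<ge> 0" and f: "mono_on {..<k} f"
    and le: "\<And>s. s \<le> k \<Longrightarrow> (\<Sum>r<s. b r) \<le> (\<Sum>r<s. f r)"
  shows "(\<Prod>r<k. b r) \<le> (\<Prod>r<k. f r)"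
proof -
  have f0: "f r \<ge> b 0" if "r < k" for r
    using le[of 1] monotone_onD[OF f, of 0 r] that by auto
  show ?thesis
  proof (cases "\<exists>r<k. f r = 0 \<or> b r = 0")
    \<comment> \<open>If some \<open>f r\<close> is 0, then so is \<open>b 0\<close>, because it
      lies between 0 and \<open>f r\<close>; hence the left product vanishes in every degenerate
      case.\<close>
    case True
    have fnn: "f r \<ge> 0" if "r < k" for r
      using f0[OF that] b[of 0] that by linarith
    have "?thesis" if "r < k" "b r = 0" for r
    proof -
      have "(\<Prod>r<k. b r) = 0" using that by (auto intro!: prod_zero)
      moreover have "(\<Prod>r<k. f r) \<ge> 0" using fnn by (intro prod_nonneg) auto
      ultimately show ?thesis by linarith
    qed
    moreover have "b 0 = 0" if "r < k" "f r = 0" for r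
      using f0[OF that(1)] that b[of 0] by auto
    ultimately show ?thesis using True by (metis gr_zeroI less_nat_zero_code)
  next
    case False
    have fpos: "f r > 0" if "r < k" for r
      using f0[OF that] b[of 0] False that by fastforce
    have "(\<Sum>r<k. inverse (f r) * (b r - f r)) \<le> 0"
    proof (rule abel_sum_nonpos)
      show "antimono_on {..<k} (\<lambda>r. inverse (f r))"
        using fpos f by (auto simp: monotone_on_def intro!: le_imp_inverse_le)
    qed (use fpos le in \<open>auto simp: sum_subtractf less_imp_le\<close>)
    also have "(\<Sum>r<k. inverse (f r) * (b r - f r)) = (\<Sum>r<k. b r / f r - 1)"
    proof (rule sum.cong)
      fix r assume "r \<in> {..<k}"
      then show "inverse (f r) * (b r - f r) = b r / f r - 1"
        using fpos[of r] by (simp add: field_simps)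
    qed simp
    finally have sum: "(\<Sum>r<k. b r / f r - 1) \<le> 0" .
    have "(\<Prod>r<k. b r / f r) \<le> (\<Prod>r<k. exp (b r / f r - 1))"
    proof (rule prod_mono)
      fix r assume "r \<in> {..<k}"
      then show "0 \<le> b r / f r \<and> b r / f r \<le> exp (b r / f r - 1)"
        using b[of r] fpos[of r] exp_ge_add_one_self[of "b r / f r - 1"] by auto
    qed
    also have "\<dots> \<le> 1" unfolding exp_sum[OF finite_lessThan, symmetric] using sum by simp
    finally show ?thesis using prod_pos[of "{..<k}" f] fpos
      by (simp add: prod_dividef divide_le_eq)
  qed
qed

text \<open>Sorting \<open>T\<close> by \<open>f\<close> reduces to the previous lemma: the first
  \<open>s\<close> entries form an \<open>s\<close>-element subset of \<open>T\<close>. A bound over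
  all subsets is the form in which Lidskii's inequality arrives.\<close>

lemma weak_supermajorization_prod_le_set:
  fixes b :: "nat \<Rightarrow> real" and f :: "'a \<Rightarrow> real"
  assumes T: "finite T" and b: "\<And>r. r < card T \<Longrightarrow> b r \<ge> 0"
    and le: "\<And>S. S \<subseteq> T \<Longrightarrow> (\<Sum>r<card S. b r) \<le> (\<Sum>t\<in>S. f t)"
  shows "(\<Prod>r<card T. b r) \<le> (\<Prod>t\<in>T. f t)"
proof -
  obtain ys where ys: "set ys = T" "distinct ys" using finite_distinct_list[OF T] by blast
  define xs where "xs = sort_key f ys"
  have xs: "set xs = T" "distinct xs" "sorted (map f xs)" "length xs = card T"
    using ys distinct_card[OF ys(2)] by (auto simp: xs_def)
  have inj: "inj_on ((!) xs) {..<s}" if "s \<le> card T" for s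
    using that xs(2,4) by (auto simp: inj_on_def nth_eq_iff_index_eq)
  have "(\<Prod>r<card T. b r) \<le> (\<Prod>r<card T. f (xs ! r))"
  proof (rule weak_supermajorization_prod_le[OF b])
    show "mono_on {..<card T} (\<lambda>r. f (xs ! r))"
      using xs(3,4) sorted_nth_mono[of "map f xs"] by (auto simp: monotone_on_def)
    fix s assume s: "s \<le> card T"
    have "(!) xs ` {..<s} \<subseteq> T" using s xs(1,4) by auto
    from le[OF this] show "(\<Sum>r<s. b r) \<le> (\<Sum>r<s. f (xs ! r))"
      by (simp add: card_image[OF inj[OF s]] sum.reindex[OF inj[OF s]])
  qed
  also have "\<dots> = (\<Prod>t\<in>T. f t)"
    by (rule prod.reindex_bij_betw[OF bij_betw_nth[OF xs(2)]]) (use xs(1,4) in auto)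
  finally show ?thesis .
qed

text \<open>Writing the summands as squares avoids roots in the mixed terms. In the induction,
  multiplying by \<open>u\<^sup>2 + v\<^sup>2\<close> at least doubles the \<open>2 ^ k - 2\<close>
  old mixed terms and creates two new ones, and
  \<open>2 * (2 ^ k - 2) + 2 = 2 ^ Suc k - 2\<close>.\<close>

lemma power_add_ge_mixed:
  fixes u v :: real
  assumes "u \<ge> 0" "v \<ge> 0" "k \<ge> 1"
  shows "u\<^sup>2 ^ k + v\<^sup>2 ^ k + (2 ^ k - 2) * (u * v) ^ k \<le> (u\<^sup>2 + v\<^sup>2) ^ k"
  using assms(3)
proof (induction k rule: dec_induct)
  case (step k)
  define p where "p = u ^ k"
  define q where "q = v ^ k"
  have pq: "p \<ge> 0" "q \<ge> 0" using assms by (auto simp: p_def q_def)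
  have pow: "u\<^sup>2 ^ k = p\<^sup>2" "v\<^sup>2 ^ k = q\<^sup>2" "(u * v) ^ k = p * q"
    by (simp_all add: p_def q_def power_mult_distrib flip: power_mult) (simp_all add: mult.commute)
  have two: "(2::real) ^ k \<ge> 2" using step power_increasing[of 1 k "2::real"] by simp
  have uv: "2 * (u * v) \<le> u\<^sup>2 + v\<^sup>2" using sum_squares_bound[of u v] by simp
  have cross: "2 * (u * v) * (p * q) \<le> u\<^sup>2 * q\<^sup>2 + v\<^sup>2 * p\<^sup>2"
    using sum_squares_bound[of "u * q" "v * p"] by (simp add: power_mult_distrib algebra_simps)
  have mixed: "2 * (u * v) * ((2 ^ k - 2) * (p * q)) \<le> (u\<^sup>2 + v\<^sup>2) * ((2 ^ k - 2) * (p * q))"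
    using two pq uv by (intro mult_right_mono) auto
  have "u\<^sup>2 ^ Suc k + v\<^sup>2 ^ Suc k + (2 ^ Suc k - 2) * (u * v) ^ Suc k =
      u\<^sup>2 * p\<^sup>2 + v\<^sup>2 * q\<^sup>2 + 2 * (u * v) * (p * q) + 2 * (u * v) * ((2 ^ k - 2) * (p * q))"
    unfolding power_Suc pow by (simp add: algebra_simps)
  also have "\<dots> \<le> (u\<^sup>2 + v\<^sup>2) * (p\<^sup>2 + q\<^sup>2 + (2 ^ k - 2) * (p * q))"
    using cross mixed by (simp add: algebra_simps)
  also have "\<dots> \<le> (u\<^sup>2 + v\<^sup>2) ^ Suc k"
    using step.IH unfolding pow power_Suc by (intro mult_left_mono) auto
  finally show ?case .
qed simp

text \<open>The \<open>k\<close>-th power of the hypothesis, with its left side expanded by the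
  previous lemma at the square roots of the two products.\<close>

lemma prod_ge_of_prod_root_ge:
  fixes a b c :: "'a \<Rightarrow> real"
  assumes I: "finite I" "I \<noteq> {}" and k: "card I = k"
    and a: "\<And>i. i \<in> I \<Longrightarrow> a i \<ge> 0" and b: "\<And>i. i \<in> I \<Longrightarrow> b i \<ge> 0"
    and c: "\<And>i. i \<in> I \<Longrightarrow> c i \<ge> 0"
    and le: "(\<Prod>i\<in>I. root k (a i)) + (\<Prod>i\<in>I. root k (b i)) \<le> (\<Prod>i\<in>I. root k (c i))"
  shows "(\<Prod>i\<in>I. a i) + (\<Prod>i\<in>I. b i) + (2 ^ k - 2) * (\<Prod>i\<in>I. sqrt (a i * b i)) \<le> (\<Prod>i\<in>I. c i)"
proof -
  have k0: "k \<ge> 1" using I k card_gt_0_iff[of I] by simp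
  define x where "x = (\<Prod>i\<in>I. root k (a i))"
  define y where "y = (\<Prod>i\<in>I. root k (b i))"
  have xy: "x \<ge> 0" "y \<ge> 0"
    unfolding x_def y_def by (intro prod_nonneg real_root_ge_zero a b; assumption)+
  have pow: "(\<Prod>i\<in>I. root k (f i)) ^ k = (\<Prod>i\<in>I. f i)" if "\<And>i. i \<in> I \<Longrightarrow> f i \<ge> 0" for f
    using that k0 by (simp add: prod_power_distrib)
  have xk: "x ^ k = (\<Prod>i\<in>I. a i)" and yk: "y ^ k = (\<Prod>i\<in>I. b i)"
    unfolding x_def y_def by (rule pow; fact)+
  have "(sqrt x * sqrt y) ^ k = sqrt (x ^ k * y ^ k)"
    by (simp add: real_sqrt_mult real_sqrt_power power_mult_distrib)
  also have "\<dots> = (\<Prod>i\<in>I. sqrt (a i * b i))"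
    \<comment> \<open>\<open>sqrt\<close> is \<open>root 2\<close>, so it distributes over the
      product like any other root.\<close>
    unfolding xk yk prod.distrib[symmetric] sqrt_def by (rule real_root_prod) simp
  finally have "x ^ k + y ^ k + (2 ^ k - 2) * (\<Prod>i\<in>I. sqrt (a i * b i)) \<le> (x + y) ^ k"
    using power_add_ge_mixed[of "sqrt x" "sqrt y" k] xy k0 by simp
  also have "\<dots> \<le> (\<Prod>i\<in>I. root k (c i)) ^ k"
    using le xy unfolding x_def y_def by (intro power_mono) auto
  also have "\<dots> = (\<Prod>i\<in>I. c i)" by (rule pow[OF c])
  finally show ?thesis unfolding xk yk .
qed

section \<open>Product inequalities for eigenvalues\<close>

text \<open>Weyl monotonicity against the zero matrix, which \<open>?Z\<close> presents in
  diagonalized form.\<close>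

lemma psd_eigenvalues_desc_nonneg:
  assumes A: "A \<in> carrier_mat n n" "psd_mat A" and i: "i < n"
  shows "eigenvalues_desc A ! i \<ge> 0"
proof -
  have herm: "hermitian_mat A" using A(2) by (simp add: psd_mat_def)
  let ?Z = "1\<^sub>m n * mat_diag n (\<lambda>i. complex_of_real 0) * mat_adjoint (1\<^sub>m n)"
  have Z: "unitarily_diagonalizes n (1\<^sub>m n) (\<lambda>_. 0) ?Z"
    unfolding unitarily_diagonalizes_def by simp
  obtain U where U: "unitarily_diagonalizes n U ((!) (eigenvalues_desc A)) A"
    using hermitian_eigenvalues_desc(3)[OF A(1) herm] by blast
  have "0 + 0 \<le> eigenvalues_desc A ! i"
  proof (rule weyl_monotonicity[OF Z U _ hermitian_eigenvalues_desc(2)[OF A(1) herm] _ i])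
    fix x :: "complex vec" assume x: "x \<in> carrier_vec n"
    then show "Re ((?Z *\<^sub>v x) \<bullet>c x) + 0 * Re (x \<bullet>c x) \<le> Re ((A *\<^sub>v x) \<bullet>c x)"
      unfolding unitarily_diagonalizes_quadratic_form[OF Z x] using A unfolding psd_mat_def by auto
  qed (auto simp: monotone_on_def)
  then show ?thesis by simp
qed

theorem theorem3p1:
  fixes n k :: nat and i :: "nat \<Rightarrow> nat" and A B :: "complex mat"
  assumes "1 \<le> n" and "1 \<le> k" and "k \<le> n"
    and "strict_mono_on {1..k} i" and "\<forall>t\<in>{1..k}. 1 \<le> i t \<and> i t \<le> n"
    and "A \<in> carrier_mat n n" and "B \<in> carrier_mat n n"
    and "psd_mat A" and "psd_mat B"
  shows "(\<Prod>t=1..k. root k (eig (i t) (A + B)))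
           \<ge> (\<Prod>t=1..k. root k (eig (i t) A)) + (\<Prod>t=1..k. root k (eig (n - t + 1) B))
       \<and> (\<Prod>t=1..k. eig (i t) (A + B))
           \<ge> (\<Prod>t=1..k. eig (i t) A) + (\<Prod>t=1..k. eig (n - t + 1) B)
              + (2 ^ k - 2) * (\<Prod>t=1..k. sqrt (eig (i t) A * eig (n - t + 1) B))"
proof -
  note k = \<open>1 \<le> k\<close> \<open>k \<le> n\<close> and A = \<open>A \<in> carrier_mat n n\<close> and B = \<open>B \<in> carrier_mat n n\<close>
  have hA: "hermitian_mat A" and hB: "hermitian_mat B"
    using \<open>psd_mat A\<close> \<open>psd_mat B\<close> by (auto simp: psd_mat_def)
  let ?I = "{1..k}"
  define a where "a t = eig (i t) A" for t
  define b where "b t = eig (n - t + 1) B" for t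
  define c where "c t = eig (i t) (A + B)" for t
  define d where "d t = c t - a t" for t
  have a: "a t \<ge> 0" if "t \<in> ?I" for t
    unfolding a_def eig_def
    by (rule psd_eigenvalues_desc_nonneg[OF A \<open>psd_mat A\<close>]) (use assms(5) that in force)
  have b: "b t \<ge> 0" if "t \<in> ?I" for t
    unfolding b_def eig_def
    by (rule psd_eigenvalues_desc_nonneg[OF B \<open>psd_mat B\<close>]) (use k that in auto)
  \<comment> \<open>\<open>eig\<close> counts from 1 and the lists from 0; as \<open>i t\<close> is
    at least 1, the truncated subtraction stays injective.\<close>
  have inj: "inj_on (\<lambda>t. i t - 1) ?I"
  proof (rule inj_onI)
    fix s t assume "s \<in> ?I" "t \<in> ?I" "i s - 1 = i t - 1"
    then have "i s = i t" using assms(5) by (metis le_add_diff_inverse)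
    then show "s = t"
      using strict_mono_on_imp_inj_on[OF assms(4)] \<open>s \<in> ?I\<close> \<open>t \<in> ?I\<close> by (auto dest: inj_onD)
  qed
  have lidskii_b: "(\<Sum>r<card S. b (Suc r)) \<le> (\<Sum>t\<in>S. d t)" if S: "S \<subseteq> ?I" for S
  proof -
    have injS: "inj_on (\<lambda>t. i t - 1) S" using inj S by (rule inj_on_subset)
    have "(\<lambda>t. i t - 1) ` S \<subseteq> {..<n}" using S assms(5) by fastforce
    from lidskii[OF A hA B hB this, unfolded card_image[OF injS] sum.reindex[OF injS]]
    show ?thesis by (simp add: b_def d_def c_def a_def eig_def)
  qed
  \<comment> \<open>The one-element case of Lidskii gives \<open>d t \<ge> b 1\<close>; Minkowski's
    inequality requires this sign.\<close>
  have d: "d t \<ge> 0" if "t \<in> ?I" for t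
    using lidskii_b[of "{t}"] b[of 1] k that by auto
  have "(\<Prod>r<k. b (Suc r)) \<le> (\<Prod>t=1..k. d t)"
    using weak_supermajorization_prod_le_set[of ?I "\<lambda>r. b (Suc r)" d] lidskii_b b by auto
  also have "(\<Prod>r<k. b (Suc r)) = (\<Prod>t=1..k. b t)"
    by (rule prod.reindex_bij_witness[of _ "\<lambda>t. t - 1" Suc]) auto
  finally have bd: "(\<Prod>t=1..k. b t) \<le> (\<Prod>t=1..k. d t)" .
  have "(\<Prod>t=1..k. root k (a t)) + (\<Prod>t=1..k. root k (b t)) \<le>
      (\<Prod>t=1..k. root k (a t)) + (\<Prod>t=1..k. root k (d t))"
    \<comment> \<open>Pulling the root out of each product leaves the monotonicity of
      \<open>root k\<close>.\<close>
    using bd k by (simp flip: real_root_prod)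
  also have "\<dots> \<le> (\<Prod>t=1..k. root k (a t + d t))"
    by (rule minkowski_prod_root) (use k a d in auto)
  finally have first: "(\<Prod>t=1..k. root k (a t)) + (\<Prod>t=1..k. root k (b t)) \<le> (\<Prod>t=1..k. root k (c t))"
    by (simp add: d_def)
  have "(\<Prod>t=1..k. a t) + (\<Prod>t=1..k. b t) + (2 ^ k - 2) * (\<Prod>t=1..k. sqrt (a t * b t)) \<le> (\<Prod>t=1..k. c t)"
  proof (rule prod_ge_of_prod_root_ge[OF _ _ _ a b _ first])
    fix t assume "t \<in> ?I"
    then show "c t \<ge> 0" using a[of t] d[of t] by (simp add: d_def)
  qed (use k in auto)
  with first show ?thesis unfolding a_def b_def c_def by blast
qed

end
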